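(* Let $K$ be a field and $n\ge 2$ an integer. For each $a\in K\setminus\{0,-1\}$ and each $L\in\mathcal{L}$, the matrix $\widetilde{M}=M(L,a)$ defines a graded twisting map, i.e. $M:=\widetilde{M}+Y$ is the matrix of a graded twisting map $K[y]\otimes K[x]\to K[x]\otimes K[y]$.
   Context: $\mathbb{N}=\{1,2,\dots\}$, $\mathbb{N}_0=\mathbb{N}\cup\{0\}$. $\Delta(n,n+1)$ is the set of sequences $L=(L_1,L_2,\dots)\in\mathbb{N}^{\mathbb{N}}$ with $L_1=n$ and $L_{j+1}-L_j\in\{n,n+1\}$ for all $j\ge 1$. The set of quasi-balanced sequences is $\mathcal{L}=\{L\in\Delta(n,n+1): L_r-1\le L_j+L_{r-j}\le L_r\text{ for all }0<j<r\}$. For $a\in K\setminus\{0,-1\}$ put $d:=\frac{1}{1+a}$, let $E_j$ ($j\in\mathbb{N}_0$) be the standard basis row vectors, and define the infinite matrix $M(L,a)$ (indexed by $\mathbb{N}_0\times\mathbb{N}_0$) by its rows: $M(L,a)_{j*}=E_0-E_1$ if $j<L_1$; $M(L,a)_{j*}=d^k(E_0-E_1)$ if $L_k<j<L_{k+1}$ for some $k$; $M(L,a)_{j*}=d^kE_0-d^{k-1}E_1+aE_{L_k+1}$ if $j=L_k$ for some $k$. Tensor products are over $K$; $\mu_{K[x]},\mu_{K[y]}$ denote multiplication. $L(K^{\mathbb{N}_0})$ is the algebra of infinite matrices over $K$ indexed by $\mathbb{N}_0\times\mathbb{N}_0$ with finitely many nonzero entries in each row; $Y$ is the matrix with $Y_{ij}=\delta_{i+1,j}$.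 A twisting map is a $K$-linear map $\tau:K[y]\otimes K[x]\to K[x]\otimes K[y]$ such that $\tau(1\otimes f)=f\otimes 1$ and $\tau(y^r\otimes 1)=1\otimes y^r$ for all $f\in K[x]$, $r\ge 0$; $\tau\circ(\mathrm{id}_{K[y]}\otimes\mu_{K[x]})=(\mu_{K[x]}\otimes \mathrm{id}_{K[y]})\circ(\mathrm{id}_{K[x]}\otimes\tau)\circ(\tau\otimes \mathrm{id}_{K[x]})$; and $\tau\circ(\mu_{K[y]}\otimes\mathrm{id}_{K[x]})=(\mathrm{id}_{K[x]}\otimes\mu_{K[y]})\circ(\tau\otimes\mathrm{id}_{K[y]})\circ(\mathrm{id}_{K[y]}\otimes\tau)$. It is graded if $\tau(y^r\otimes x^i)$ lies in the span of $\{x^{r+i-j}\otimes y^j:0\le j\le r+i\}$ for all $r,i$. The matrix of a graded twisting map $\tau$ is the matrix $M\in L(K^{\mathbb{N}_0})$ with $\tau(y^k\otimes x)=\sum_{j=0}^{k+1}M_{kj}\,x^{k+1-j}\otimes y^j$ and $M_{kj}=0$ for $j>k+1$. A matrix $M\in L(K^{\mathbb{N}_0})$ is the matrix of a (unique) graded twisting map if and only if $M_{0j}=\delta_{0j}$, $M_{kj}=0$ for $j>k+1$, and $Y^kM=\sum_{j=0}^{k+1}M_{kj}M^{k+1-j}Y^j$ for all $k\in\mathbb{N}_0$. *)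

theory Defs
  imports Complex_Main "HOL-Library.Poly_Mapping"
begin

text \<open>
  Everything lives in vector spaces with a distinguished basis: the type \<open>'b \<Rightarrow>\<^sub>0 'k\<close> of finitely
  supported functions is the \<open>'k\<close>-vector space with basis \<open>'b\<close>. For \<open>'b = nat\<close> the library
  multiplication on this type is convolution, so \<open>nat \<Rightarrow>\<^sub>0 'k\<close> is the polynomial ring in one
  variable; it serves both as K[x] and as K[y].
\<close>

abbreviation "lookup \<equiv> Poly_Mapping.lookup"
abbreviation "keys \<equiv> Poly_Mapping.keys"

definition smul :: "'k::field \<Rightarrow> ('b \<Rightarrow>\<^sub>0 'k) \<Rightarrow> ('b \<Rightarrow>\<^sub>0 'k)"
  where "smul c f = Poly_Mapping.map ((*) c) f"

lemma lookup_smul [simp]: "lookup (smul c f) b = c * lookup f b"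
  by (simp add: smul_def Poly_Mapping.map.rep_eq when_def)

global_interpretation pm: vector_space smul
  by unfold_locales (auto intro!: poly_mapping_eqI simp: lookup_add algebra_simps)

definition basis :: "'b \<Rightarrow> ('b \<Rightarrow>\<^sub>0 'k::field)"
  where "basis b = Poly_Mapping.single b 1"

lemma lookup_basis: "lookup (basis b) c = (if b = c then 1 else 0)"
  by (simp add: basis_def lookup_single when_def)

lemma basis_expansion: "f = (\<Sum>b\<in>keys f. smul (lookup f b) (basis b))"
proof (rule poly_mapping_eqI)
  fix c
  have "lookup (\<Sum>b\<in>keys f. smul (lookup f b) (basis b)) c
      = (\<Sum>b\<in>keys f. if c = b then lookup f b else 0)"
    unfolding lookup_sum by (rule sum.cong) (auto simp: lookup_basis)
  also have "\<dots> = lookup f c"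
    by (simp add: in_keys_iff)
  finally show "lookup f c = lookup (\<Sum>b\<in>keys f. smul (lookup f b) (basis b)) c" by simp
qed

type_synonym 'k polynomial = "nat \<Rightarrow>\<^sub>0 'k"

definition X :: "'k::field polynomial"
  where "X = Poly_Mapping.single 1 1"

lemma X_power: "X ^ i = basis i"
  by (induction i) (simp_all add: X_def basis_def mult_single)


section \<open>Tensor products\<close>

text \<open>
  The tensor product of the spaces with bases \<open>'b\<close> and \<open>'c\<close> is the space with basis \<open>'b \<times> 'c\<close>.
  Lemmas \<open>bilinear_tensor\<close>, \<open>tensor_lift_tensor\<close>, \<open>linear_tensor_lift\<close> and
  \<open>tensor_linear_unique\<close> are its universal property.
\<close>

definition tensor :: "('b \<Rightarrow>\<^sub>0 'k::field) \<Rightarrow> ('c \<Rightarrow>\<^sub>0 'k) \<Rightarrow> ('b \<times> 'c \<Rightarrow>\<^sub>0 'k)"  (infixr "\<otimes>" 75)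
  where "f \<otimes> g = (\<Sum>b\<in>keys f. \<Sum>c\<in>keys g. Poly_Mapping.single (b, c) (lookup f b * lookup g c))"

definition bilinear_map ::
  "(('b \<Rightarrow>\<^sub>0 'k::field) \<Rightarrow> ('c \<Rightarrow>\<^sub>0 'k) \<Rightarrow> ('d \<Rightarrow>\<^sub>0 'k)) \<Rightarrow> bool"
  where "bilinear_map B \<longleftrightarrow>
    (\<forall>f. Vector_Spaces.linear smul smul (B f)) \<and>
    (\<forall>g. Vector_Spaces.linear smul smul (\<lambda>f. B f g))"

definition tensor_lift ::
  "(('b \<Rightarrow>\<^sub>0 'k::field) \<Rightarrow> ('c \<Rightarrow>\<^sub>0 'k) \<Rightarrow> ('d \<Rightarrow>\<^sub>0 'k)) \<Rightarrow> ('b \<times> 'c \<Rightarrow>\<^sub>0 'k) \<Rightarrow> ('d \<Rightarrow>\<^sub>0 'k)"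
  where "tensor_lift B t = (\<Sum>p\<in>keys t. smul (lookup t p) (B (basis (fst p)) (basis (snd p))))"

definition tensor_map ::
  "(('b \<Rightarrow>\<^sub>0 'k::field) \<Rightarrow> ('d \<Rightarrow>\<^sub>0 'k)) \<Rightarrow> (('c \<Rightarrow>\<^sub>0 'k) \<Rightarrow> ('e \<Rightarrow>\<^sub>0 'k))
    \<Rightarrow> ('b \<times> 'c \<Rightarrow>\<^sub>0 'k) \<Rightarrow> ('d \<times> 'e \<Rightarrow>\<^sub>0 'k)"  (infixr "\<otimes>\<^sub>m" 75)
  where "\<phi> \<otimes>\<^sub>m \<psi> = tensor_lift (\<lambda>f g. \<phi> f \<otimes> \<psi> g)"

text \<open>The canonical associativity isomorphism and its inverse, by relabelling the basis.\<close>

definition assoc :: "(('b \<times> 'c) \<times> 'd \<Rightarrow>\<^sub>0 'k::field) \<Rightarrow> ('b \<times> 'c \<times> 'd \<Rightarrow>\<^sub>0 'k)"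
  where "assoc = Poly_Mapping.map_key (\<lambda>(b, c, d). ((b, c), d))"

definition unassoc :: "('b \<times> 'c \<times> 'd \<Rightarrow>\<^sub>0 'k::field) \<Rightarrow> (('b \<times> 'c) \<times> 'd \<Rightarrow>\<^sub>0 'k)"
  where "unassoc = Poly_Mapping.map_key (\<lambda>((b, c), d). (b, c, d))"

lemma linear_smulI:
  assumes "\<And>f g. \<phi> (f + g) = \<phi> f + \<phi> g" and "\<And>c f. \<phi> (smul c f) = smul c (\<phi> f)"
  shows "Vector_Spaces.linear smul smul \<phi>"
  using assms by unfold_locales auto

lemma lookup_tensor [simp]: "lookup (f \<otimes> g) (b, c) = lookup f b * lookup g c"
proof -
  have "lookup (f \<otimes> g) (b, c)
      = (\<Sum>b'\<in>keys f. \<Sum>c'\<in>keys g. if b = b' then (if c = c' then lookup f b * lookup g c else 0) else 0)"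
    by (auto simp: tensor_def lookup_sum lookup_single when_def intro!: sum.cong)
  also have "\<dots> = (\<Sum>b'\<in>keys f. if b = b' then
      (\<Sum>c'\<in>keys g. if c = c' then lookup f b * lookup g c else 0) else 0)"
    by (intro sum.cong) auto
  also have "\<dots> = lookup f b * lookup g c"
    by (simp add: in_keys_iff)
  finally show ?thesis .
qed

lemma basis_tensor_basis: "basis b \<otimes> basis c = basis (b, c)"
  by (rule poly_mapping_eqI) (auto simp: lookup_basis split: prod.splits if_splits)

lemma bilinear_tensor: "bilinear_map (\<otimes>)"
  unfolding bilinear_map_def
  by (auto intro!: linear_smulI poly_mapping_eqI simp: lookup_add algebra_simps)

lemma tensor_lift_superset:
  assumes "finite S" "keys t \<subseteq> S"
  shows "tensor_lift B t = (\<Sum>p\<in>S. smul (lookup t p) (B (basis (fst p)) (basis (snd p))))"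
  unfolding tensor_lift_def
  by (rule sum.mono_neutral_left) (use assms in \<open>auto simp: in_keys_iff\<close>)

lemma linear_tensor_lift:
  fixes B :: "('b \<Rightarrow>\<^sub>0 'k::field) \<Rightarrow> ('c \<Rightarrow>\<^sub>0 'k) \<Rightarrow> ('d \<Rightarrow>\<^sub>0 'k)"
  shows "Vector_Spaces.linear smul smul (tensor_lift B)"
proof (rule linear_smulI)
  fix f g :: "'b \<times> 'c \<Rightarrow>\<^sub>0 'k"
  let ?S = "keys f \<union> keys g"
  have "keys (f + g) \<subseteq> ?S" by (rule Poly_Mapping.keys_add)
  then show "tensor_lift B (f + g) = tensor_lift B f + tensor_lift B g"
    by (simp add: tensor_lift_superset[of ?S] lookup_add pm.scale_left_distrib sum.distrib)
next
  fix c :: 'k and f :: "'b \<times> 'c \<Rightarrow>\<^sub>0 'k"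
  have "keys (smul c f) \<subseteq> keys f" by (auto simp: in_keys_iff)
  then show "tensor_lift B (smul c f) = smul c (tensor_lift B f)"
    by (simp add: tensor_lift_superset[of "keys f"] pm.scale_sum_right)
qed

lemma tensor_linear_unique:
  assumes "Vector_Spaces.linear smul smul \<phi>" "Vector_Spaces.linear smul smul \<psi>"
    and "\<And>f g. \<phi> (f \<otimes> g) = \<psi> (f \<otimes> g)"
  shows "\<phi> = \<psi>"
proof
  fix t
  interpret f: Vector_Spaces.linear smul smul \<phi> by fact
  interpret g: Vector_Spaces.linear smul smul \<psi> by fact
  have "\<phi> (basis p) = \<psi> (basis p)" for p
    using assms(3)[of "basis (fst p)" "basis (snd p)"] by (simp add: basis_tensor_basis)
  then show "\<phi> t = \<psi> t"
    by (subst (1 2) basis_expansion) (simp add: f.sum g.sum f.scale g.scale)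
qed

lemma tensor_lift_tensor:
  fixes B :: "('b \<Rightarrow>\<^sub>0 'k::field) \<Rightarrow> ('c \<Rightarrow>\<^sub>0 'k) \<Rightarrow> ('d \<Rightarrow>\<^sub>0 'k)"
  assumes "bilinear_map B"
  shows "tensor_lift B (f \<otimes> g) = B f g"
proof -
  have l: "Vector_Spaces.linear smul smul (\<lambda>f. B f g)"
    and r: "Vector_Spaces.linear smul smul (B (basis b))" for b
    using assms by (simp_all add: bilinear_map_def)
  interpret l: Vector_Spaces.linear smul smul "\<lambda>f. B f g" by (rule l)
  have B_basis: "B (basis b) g = (\<Sum>c\<in>keys g. smul (lookup g c) (B (basis b) (basis c)))" for b
  proof -
    interpret r: Vector_Spaces.linear smul smul "B (basis b)" by (rule r)
    show ?thesis
      by (subst (1) basis_expansion) (simp add: r.sum r.scale)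
  qed
  have "keys (f \<otimes> g) \<subseteq> keys f \<times> keys g"
    by (auto simp: in_keys_iff)
  then have "tensor_lift B (f \<otimes> g) =
      (\<Sum>b\<in>keys f. \<Sum>c\<in>keys g. smul (lookup f b * lookup g c) (B (basis b) (basis c)))"
    by (subst tensor_lift_superset[of "keys f \<times> keys g"]) (auto simp: sum.cartesian_product intro!: sum.cong)
  also have "\<dots> = (\<Sum>b\<in>keys f. smul (lookup f b) (B (basis b) g))"
    by (simp add: B_basis pm.scale_sum_right)
  also have "\<dots> = B (\<Sum>b\<in>keys f. smul (lookup f b) (basis b)) g"
    by (simp add: l.sum l.scale)
  also have "\<dots> = B f g"
    by (simp only: basis_expansion[symmetric])
  finally show ?thesis .
qed

lemma tensor_map_tensor:
  assumes "Vector_Spaces.linear smul smul \<phi>" "Vector_Spaces.linear smul smul \<psi>"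
  shows "(\<phi> \<otimes>\<^sub>m \<psi>) (f \<otimes> g) = \<phi> f \<otimes> \<psi> g"
proof -
  interpret f: Vector_Spaces.linear smul smul \<phi> by fact
  interpret g: Vector_Spaces.linear smul smul \<psi> by fact
  have "bilinear_map (\<lambda>f g. \<phi> f \<otimes> \<psi> g)"
    unfolding bilinear_map_def
    by (auto intro!: linear_smulI poly_mapping_eqI
        simp: f.add g.add f.scale g.scale lookup_add algebra_simps)
  then show ?thesis
    by (simp add: tensor_map_def tensor_lift_tensor)
qed

lemma assoc_tensor: "assoc ((f \<otimes> g) \<otimes> h) = f \<otimes> (g \<otimes> h)"
  and unassoc_tensor: "unassoc (f \<otimes> (g \<otimes> h)) = (f \<otimes> g) \<otimes> h"
proof -
  have i: "inj (\<lambda>(b, c, d). ((b, c), d))" and j: "inj (\<lambda>((b, c), d). (b, c, d))"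
    by (auto simp: inj_on_def)
  show "assoc ((f \<otimes> g) \<otimes> h) = f \<otimes> (g \<otimes> h)"
    by (rule poly_mapping_eqI) (auto simp: assoc_def map_key.rep_eq[OF i] split: prod.splits)
  show "unassoc (f \<otimes> (g \<otimes> h)) = (f \<otimes> g) \<otimes> h"
    by (rule poly_mapping_eqI) (auto simp: unassoc_def map_key.rep_eq[OF j] split: prod.splits)
qed

definition mu :: "(nat \<times> nat \<Rightarrow>\<^sub>0 'k::field) \<Rightarrow> 'k polynomial"
  where "mu = tensor_lift (*)"

lemma mu_tensor: "mu (f \<otimes> g) = f * g"
proof -
  have eq: "smul c h = Poly_Mapping.single 0 c * h" for c and h :: "'a polynomial"
    by (simp add: smul_def mult_map_scale_conv_mult)
  have "bilinear_map ((*) :: 'a polynomial \<Rightarrow> _)"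
    unfolding bilinear_map_def by (auto intro!: linear_smulI simp: eq algebra_simps)
  then show ?thesis
    by (simp add: mu_def tensor_lift_tensor)
qed


section \<open>Twisting maps\<close>

text \<open>
  In the source of \<open>\<tau>\<close> the first factor is K[y] and the second K[x]; in its target the first
  is K[x] and the second K[y]. The two sides of the first compatibility condition are maps
  from (K[y] \<open>\<otimes>\<close> K[x]) \<open>\<otimes>\<close> K[x], those of the second one maps from K[y] \<open>\<otimes>\<close> (K[y] \<open>\<otimes>\<close> K[x]).
\<close>

definition twisting_map :: "((nat \<times> nat \<Rightarrow>\<^sub>0 'k::field) \<Rightarrow> (nat \<times> nat \<Rightarrow>\<^sub>0 'k)) \<Rightarrow> bool"
  where "twisting_map \<tau> \<longleftrightarrow>
    Vector_Spaces.linear smul smul \<tau> \<and>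
    (\<forall>f :: 'k polynomial. \<tau> ((1 :: 'k polynomial) \<otimes> f) = f \<otimes> (1 :: 'k polynomial)) \<and>
    (\<forall>r. \<tau> (X ^ r \<otimes> (1 :: 'k polynomial)) = (1 :: 'k polynomial) \<otimes> X ^ r) \<and>
    \<tau> \<circ> (id \<otimes>\<^sub>m mu) \<circ> assoc
      = (mu \<otimes>\<^sub>m id) \<circ> unassoc \<circ> (id \<otimes>\<^sub>m \<tau>) \<circ> assoc \<circ> (\<tau> \<otimes>\<^sub>m id) \<and>
    \<tau> \<circ> (mu \<otimes>\<^sub>m id) \<circ> unassoc
      = (id \<otimes>\<^sub>m mu) \<circ> assoc \<circ> (\<tau> \<otimes>\<^sub>m id) \<circ> unassoc \<circ> (id \<otimes>\<^sub>m \<tau>)"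

definition graded :: "((nat \<times> nat \<Rightarrow>\<^sub>0 'k::field) \<Rightarrow> (nat \<times> nat \<Rightarrow>\<^sub>0 'k)) \<Rightarrow> bool"
  where "graded \<tau> \<longleftrightarrow>
    (\<forall>r i. \<tau> (X ^ r \<otimes> X ^ i) \<in> module.span smul {X ^ (r + i - j) \<otimes> X ^ j |j. j \<le> r + i})"


section \<open>Infinite matrices with finitely supported rows\<close>

text \<open>A matrix is the function sending each row index to the corresponding row vector.\<close>

type_synonym 'k matrix = "nat \<Rightarrow> (nat \<Rightarrow>\<^sub>0 'k)"

definition is_matrix_of ::
  "'k::field matrix \<Rightarrow> ((nat \<times> nat \<Rightarrow>\<^sub>0 'k) \<Rightarrow> (nat \<times> nat \<Rightarrow>\<^sub>0 'k)) \<Rightarrow> bool"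
  where "is_matrix_of M \<tau> \<longleftrightarrow>
    (\<forall>k. \<tau> (X ^ k \<otimes> X) = (\<Sum>j = 0..k + 1. smul (lookup (M k) j) (X ^ (k + 1 - j) \<otimes> X ^ j))) \<and>
    (\<forall>k j. j > k + 1 \<longrightarrow> lookup (M k) j = 0)"

abbreviation E :: "nat \<Rightarrow> (nat \<Rightarrow>\<^sub>0 'k::field)"
  where "E \<equiv> basis"

definition Y :: "'k::field matrix"
  where "Y i = E (i + 1)"

lemma lookup_Y: "lookup (Y i) j = (if i + 1 = j then 1 else 0)"
  by (simp add: Y_def lookup_basis)


section \<open>Quasi-balanced sequences and the matrices M(L,a)\<close>

text \<open>Sequences are indexed from 1; the value at 0 is ignored throughout.\<close>

definition Delta :: "nat \<Rightarrow> (nat \<Rightarrow> nat) set"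
  where "Delta n = {L. (\<forall>j\<ge>1. 1 \<le> L j) \<and> L 1 = n \<and>
    (\<forall>j\<ge>1. L (j + 1) = L j + n \<or> L (j + 1) = L j + (n + 1))}"

definition quasi_balanced :: "nat \<Rightarrow> (nat \<Rightarrow> nat) set"
  where "quasi_balanced n = {L \<in> Delta n.
    \<forall>r j. 0 < j \<and> j < r \<longrightarrow> L r - 1 \<le> L j + L (r - j) \<and> L j + L (r - j) \<le> L r}"

text \<open>
  For \<open>j \<ge> L 1\<close> the index \<open>k\<close> below is the unique one with \<open>L k \<le> j < L (k + 1)\<close>, which covers
  both the case \<open>j = L k\<close> and the case \<open>L k < j < L (k + 1)\<close>; see \<open>M_tilde_less\<close>,
  \<open>M_tilde_between\<close> and \<open>M_tilde_eq\<close>.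
\<close>

definition M_tilde :: "(nat \<Rightarrow> nat) \<Rightarrow> 'k::field \<Rightarrow> 'k matrix"
  where "M_tilde L a j =
    (let d = 1 / (1 + a); k = (THE k. 1 \<le> k \<and> L k \<le> j \<and> j < L (k + 1)) in
      if j < L 1 then E 0 - E 1
      else if j = L k then smul (d ^ k) (E 0) - smul (d ^ (k - 1)) (E 1) + smul a (E (L k + 1))
      else smul (d ^ k) (E 0 - E 1))"

lemma Delta_less:
  assumes "L \<in> Delta n" "1 \<le> i" "i < k"
  shows "L i < L k"
proof -
  have "1 \<le> n" using assms(1) by (auto simp: Delta_def)
  have "Suc i \<le> k" using assms(3) by simp
  then show ?thesis
  proof (induction k rule: dec_induct)
    case base
    have "L (i + 1) = L i + n \<or> L (i + 1) = L i + (n + 1)"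
      using assms(1,2) unfolding Delta_def by blast
    with \<open>1 \<le> n\<close> show ?case by auto
  next
    case (step m)
    then have "1 \<le> m" using assms(2) by simp
    then have "L (m + 1) = L m + n \<or> L (m + 1) = L m + (n + 1)"
      using assms(1) unfolding Delta_def by blast
    with step show ?case by auto
  qed
qed

lemma Delta_index:
  assumes "L \<in> Delta n" "1 \<le> k" "L k \<le> j" "j < L (k + 1)"
  shows "(THE k. 1 \<le> k \<and> L k \<le> j \<and> j < L (k + 1)) = k"
proof (rule the_equality)
  fix i assume i: "1 \<le> i \<and> L i \<le> j \<and> j < L (i + 1)"
  have "L u \<le> L v" if "1 \<le> u" "u \<le> v" for u v
    using Delta_less[OF assms(1), of u v] that by (cases "u = v") auto
  from this[of "i + 1" k] this[of "k + 1" i] show "i = k"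
    using assms i by (cases i k rule: linorder_cases) auto
qed (use assms in auto)

lemma M_tilde_less: "j < L 1 \<Longrightarrow> M_tilde L a j = E 0 - E 1"
  by (simp add: M_tilde_def Let_def)

lemma Delta_not_less_1: "L \<in> Delta n \<Longrightarrow> 1 \<le> k \<Longrightarrow> L k \<le> j \<Longrightarrow> \<not> j < L 1"
  using Delta_less[of L n 1 k] by (cases "k = 1") auto

lemma M_tilde_between:
  assumes "L \<in> Delta n" "1 \<le> k" "L k < j" "j < L (k + 1)"
  shows "M_tilde L a j = smul ((1 / (1 + a)) ^ k) (E 0 - E 1)"
proof -
  have "\<not> j < L 1" "(THE k. 1 \<le> k \<and> L k \<le> j \<and> j < L (k + 1)) = k"
    using assms Delta_not_less_1[of L n k j] Delta_index[of L n k j] by auto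
  then show ?thesis using assms by (simp add: M_tilde_def Let_def)
qed

lemma M_tilde_eq:
  assumes "L \<in> Delta n" "1 \<le> k" "j = L k"
  shows "M_tilde L a j = smul ((1 / (1 + a)) ^ k) (E 0) - smul ((1 / (1 + a)) ^ (k - 1)) (E 1)
    + smul a (E (L k + 1))"
proof -
  have "\<not> j < L 1" "(THE k. 1 \<le> k \<and> L k \<le> j \<and> j < L (k + 1)) = k"
    using assms Delta_not_less_1[of L n k j] Delta_index[of L n k j] Delta_less[of L n k "k + 1"]
    by auto
  then show ?thesis using assms by (simp add: M_tilde_def Let_def)
qed

end

theory Submission
  imports Defs
begin

text \<open>
  Setting \<open>x = 1\<close> on the left turns a twisted tensor product into the space K[y], on which right
  multiplication by \<open>y\<close> is multiplication of polynomials and right multiplication by \<open>x\<close> is the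
  operator \<open>T\<close> sending \<open>y^k\<close> to the polynomial with coefficients \<open>M k\<close>. The degree of an element
  remembers the powers of \<open>x\<close> that were set to 1, so a graded twisting map can be recovered from
  \<open>T\<close>: \<open>y^k \<otimes> x^i\<close> goes to the homogenization of \<open>T^i (y^k)\<close> in degree \<open>k + i\<close>. For this map,
  compatibility with the product of K[x] is the rule \<open>T^(i + i') = T^i' \<circ> T^i\<close>, and compatibility
  with the product of K[y] is the identity \<open>relation_power\<close>, which follows by induction from its
  case of exponent 1, that is, from the matrix equations
  \<open>Y^k M = \<Sum>\<^sub>l M\<^sub>k\<^sub>l M^(k + 1 - l) Y^l\<close>. This is \<open>graded_twisting_map_of_matrix\<close>.

  It remains to check these equations for \<open>M = M(L,a) + Y\<close>. Put \<open>q = 1 + a\<close>, \<open>d = 1/q\<close>, and let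
  \<open>\<kappa> j\<close> be the number of terms of \<open>L\<close> that are smaller than \<open>j\<close>. All rows of \<open>M\<close> are then given
  by one formula (\<open>M_tilde_plus_Y\<close>), and after rescaling the basis to \<open>e\<^sub>j = q^(\<kappa> j) y^j\<close> the
  operator becomes
  \<open>T e\<^sub>j = e\<^sub>j\<^sub>+\<^sub>1 - e\<^sub>1 + u\<^sub>j e\<^sub>0\<close>, where \<open>u\<^sub>j\<close> is \<open>d\<close> if \<open>j\<close> is a term of \<open>L\<close> and 1 otherwise.
  As \<open>e\<^sub>0\<close> is fixed by \<open>T\<close>, the powers telescope to
  \<open>T^j e\<^sub>i = e\<^sub>i\<^sub>+\<^sub>j - e\<^sub>j + c\<^sub>i\<^sub>j e\<^sub>0\<close>, where
  \<open>c\<^sub>i\<^sub>j = 1 - (1 - d) (\<kappa> (i + j) - \<kappa> i - \<kappa> j)\<close>.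
  This is where \<open>L\<close> being quasi-balanced enters: the defect
  \<open>\<kappa> (i + j) - \<kappa> i - \<kappa> j\<close> is always 0 or 1 (\<open>quasi_balanced_count_below\<close>), so that
  \<open>c\<^sub>i\<^sub>j\<close> equals \<open>d\<close> to the power of the defect. With these
  closed forms the matrix equations reduce to comparing the coefficients of four basis vectors.
\<close>

section \<open>Linear maps and bases\<close>

text \<open>
  The maps of the twisting axioms are compared on basis vectors (\<open>lin_eq_on_basis\<close>); sums over
  supports are handled as values of linear extensions, through \<open>lin_image_lin_ext\<close>.
\<close>

abbreviation lin :: "(('b \<Rightarrow>\<^sub>0 'k::field) \<Rightarrow> ('c \<Rightarrow>\<^sub>0 'k)) \<Rightarrow> bool"
  where "lin \<equiv> Vector_Spaces.linear smul smul"

definition lin_ext :: "('b \<Rightarrow> ('c \<Rightarrow>\<^sub>0 'k::field)) \<Rightarrow> ('b \<Rightarrow>\<^sub>0 'k) \<Rightarrow> ('c \<Rightarrow>\<^sub>0 'k)"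
  where "lin_ext \<phi> f = (\<Sum>b\<in>keys f. smul (lookup f b) (\<phi> b))"

lemma lin_ext_superset:
  assumes "finite S" "keys f \<subseteq> S"
  shows "lin_ext \<phi> f = (\<Sum>b\<in>S. smul (lookup f b) (\<phi> b))"
  unfolding lin_ext_def
  by (rule sum.mono_neutral_left) (use assms in \<open>auto simp: in_keys_iff\<close>)

lemma lin_ext_add: "lin_ext \<phi> (f + g) = lin_ext \<phi> f + lin_ext \<phi> g"
  using Poly_Mapping.keys_add[of f g]
  by (simp add: lin_ext_superset[of "keys f \<union> keys g"] lookup_add pm.scale_left_distrib
      sum.distrib)

lemma lin_ext_smul: "lin_ext \<phi> (smul c f) = smul c (lin_ext \<phi> f)"
proof -
  have "keys (smul c f) \<subseteq> keys f" by (auto simp: in_keys_iff)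
  then show ?thesis
    by (simp add: lin_ext_superset[of "keys f"] pm.scale_sum_right)
qed

lemma lin_lin_ext: "lin (lin_ext \<phi>)"
  by (intro linear_smulI lin_ext_add lin_ext_smul)

lemma lin_ext_basis [simp]: "lin_ext \<phi> (basis b) = \<phi> b"
  by (simp add: lin_ext_def basis_def)

lemma lin_ext_cong: "(\<And>b. b \<in> keys f \<Longrightarrow> \<phi> b = \<psi> b) \<Longrightarrow> lin_ext \<phi> f = lin_ext \<psi> f"
  by (simp add: lin_ext_def)

context
  fixes \<phi> :: "('b \<Rightarrow>\<^sub>0 'k::field) \<Rightarrow> ('c \<Rightarrow>\<^sub>0 'k)"
  assumes lin: "lin \<phi>"
begin

interpretation Vector_Spaces.linear smul smul \<phi> by (rule lin)

lemma lin_add: "\<phi> (f + g) = \<phi> f + \<phi> g"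
  and lin_diff: "\<phi> (f - g) = \<phi> f - \<phi> g"
  and lin_smul: "\<phi> (smul c f) = smul c (\<phi> f)"
  and lin_sum: "\<phi> (sum h A) = (\<Sum>x\<in>A. \<phi> (h x))"
  by (rule add diff scale sum)+

end

lemma lin_image_lin_ext: "lin \<psi> \<Longrightarrow> \<psi> (lin_ext \<phi> f) = lin_ext (\<lambda>b. \<psi> (\<phi> b)) f"
  by (simp add: lin_ext_def lin_sum lin_smul)

lemma lin_ext_basis_id: "lin_ext basis f = f"
  by (simp add: lin_ext_def basis_expansion[symmetric])

lemma lin_eq_on_basis:
  assumes "lin \<phi>" "lin \<psi>" "\<And>b. \<phi> (basis b) = \<psi> (basis b)"
  shows "\<phi> = \<psi>"
proof
  fix f
  show "\<phi> f = \<psi> f"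
    using lin_image_lin_ext[OF assms(1), of basis f] lin_image_lin_ext[OF assms(2), of basis f]
    by (simp add: lin_ext_basis_id assms(3))
qed

lemma lin_id: "lin id"
  by (intro linear_smulI) auto

lemma lin_comp: "lin \<phi> \<Longrightarrow> lin \<psi> \<Longrightarrow> lin (\<phi> \<circ> \<psi>)"
  by (rule linear_smulI) (simp_all add: lin_add lin_smul)

lemma lin_funpow:
  fixes \<phi> :: "('b \<Rightarrow>\<^sub>0 'k::field) \<Rightarrow> ('b \<Rightarrow>\<^sub>0 'k)"
  shows "lin \<phi> \<Longrightarrow> lin (\<phi> ^^ m)"
proof (induction m)
  case (Suc m)
  then show ?case using lin_comp[of \<phi> "\<phi> ^^ m"] by (simp add: comp_def)
qed (use lin_id in simp)

lemma smul_conv_mult: "smul c f = Poly_Mapping.single 0 c * f" for f :: "'k::field polynomial"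
  by (simp add: smul_def mult_map_scale_conv_mult)

lemma lin_mult: "lin ((*) f)" for f :: "'k::field polynomial"
  by (rule linear_smulI) (simp_all add: smul_conv_mult algebra_simps)

lemma lin_tensor_left: "lin (\<lambda>f. f \<otimes> g)" and lin_tensor_right: "lin ((\<otimes>) f)"
  using bilinear_tensor unfolding bilinear_map_def by blast+

lemma lin_tensor_map: "lin (\<phi> \<otimes>\<^sub>m \<psi>)"
  unfolding tensor_map_def by (rule linear_tensor_lift)

lemma lin_mu: "lin mu"
  unfolding mu_def by (rule linear_tensor_lift)

lemma lin_assoc: "lin assoc"
proof -
  have i: "inj (\<lambda>(b, c, d). ((b, c), d))" by (auto simp: inj_on_def)
  show ?thesis
    by (intro linear_smulI poly_mapping_eqI)
      (auto simp: assoc_def map_key.rep_eq[OF i] lookup_add)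
qed

lemma lin_unassoc: "lin unassoc"
proof -
  have i: "inj (\<lambda>((b, c), d). (b, c, d))" by (auto simp: inj_on_def)
  show ?thesis
    by (intro linear_smulI poly_mapping_eqI)
      (auto simp: unassoc_def map_key.rep_eq[OF i] lookup_add)
qed

lemma basis_mult_basis: "basis i * basis j = (basis (i + j) :: 'k::field polynomial)"
  by (simp add: basis_def mult_single)

lemma X_eq_basis: "X = basis 1"
  by (simp add: X_def basis_def)

lemma one_eq_basis: "1 = (basis 0 :: 'k::field polynomial)"
  by (simp add: basis_def)

lemma tensor_map_basis: "(\<phi> \<otimes>\<^sub>m \<psi>) (basis (b, c)) = \<phi> (basis b) \<otimes> \<psi> (basis c)"
  unfolding tensor_map_def tensor_lift_def by (simp add: basis_def)

lemma mu_basis: "mu (basis (i, j)) = basis (i + j)"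
  using mu_tensor[of "basis i" "basis j"] by (simp add: basis_tensor_basis basis_mult_basis)

lemma assoc_basis: "assoc (basis ((b, c), d)) = basis (b, c, d)"
  using assoc_tensor[of "basis b" "basis c" "basis d"] by (simp add: basis_tensor_basis)

lemma unassoc_basis: "unassoc (basis (b, c, d)) = basis ((b, c), d)"
  using unassoc_tensor[of "basis b" "basis c" "basis d"] by (simp add: basis_tensor_basis)


section \<open>Graded twisting maps from matrices\<close>

text \<open>
  Homogenization in degree \<open>N\<close>, \<open>y^j \<mapsto> x^(N - j) \<otimes> y^j\<close>, to be used on polynomials of degree
  at most \<open>N\<close>.
\<close>

definition homog :: "nat \<Rightarrow> 'k::field polynomial \<Rightarrow> (nat \<times> nat \<Rightarrow>\<^sub>0 'k)"
  where "homog N = lin_ext (\<lambda>j. basis (N - j, j))"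

lemma lin_homog: "lin (homog N)"
  unfolding homog_def by (rule lin_lin_ext)

lemma mu_right_homog: "(id \<otimes>\<^sub>m mu) (assoc (homog N p \<otimes> basis j)) = homog (N + j) (X ^ j * p)"
proof -
  have "(id \<otimes>\<^sub>m mu) \<circ> assoc \<circ> (\<lambda>f. f \<otimes> basis j) \<circ> homog N = homog (N + j) \<circ> (*) (X ^ j)"
    by (intro lin_eq_on_basis lin_comp lin_tensor_map lin_assoc lin_tensor_left lin_homog lin_mult)
      (simp add: homog_def X_power basis_mult_basis basis_tensor_basis assoc_basis tensor_map_basis mu_basis
        add.commute)
  then show ?thesis by (metis comp_apply)
qed

text \<open>
  Multiplying on the left by \<open>x^m\<close> raises the degree of homogenization. In contrast to
  multiplication by a power of \<open>y\<close> this needs the degree bound: the exponent \<open>m + (N - j)\<close> is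
  \<open>(m + N) - j\<close> only when \<open>N - j\<close> is not truncated.
\<close>

lemma mu_left_homog:
  assumes "keys p \<subseteq> {..N}"
  shows "(mu \<otimes>\<^sub>m id) (unassoc (basis m \<otimes> homog N p)) = homog (m + N) p"
proof -
  have l: "lin ((mu \<otimes>\<^sub>m id) \<circ> unassoc \<circ> (\<otimes>) (basis m))"
    by (intro lin_comp lin_tensor_map lin_unassoc lin_tensor_right)
  have "((mu \<otimes>\<^sub>m id) \<circ> unassoc \<circ> (\<otimes>) (basis m)) (homog N p) = homog (m + N) p"
    unfolding homog_def lin_image_lin_ext[OF l]
    by (rule lin_ext_cong)
      (use assms in \<open>auto simp: basis_tensor_basis unassoc_basis tensor_map_basis mu_basis\<close>)
  then show ?thesis by simp
qed

lemma funpow_degree: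
  assumes "\<And>k. keys (M k) \<subseteq> {..Suc k}"
  shows "keys ((lin_ext M ^^ m) (basis k)) \<subseteq> {..k + m}"
proof (induction m)
  case (Suc m)
  let ?p = "(lin_ext M ^^ m) (basis k)"
  have "keys (lin_ext M ?p) \<subseteq> (\<Union>b\<in>keys ?p. keys (M b))"
  proof
    fix x assume "x \<in> keys (lin_ext M ?p)"
    then have "(\<Sum>b\<in>keys ?p. lookup ?p b * lookup (M b) x) \<noteq> 0"
      by (simp add: lin_ext_def in_keys_iff lookup_sum)
    then obtain b where "b \<in> keys ?p" "lookup ?p b * lookup (M b) x \<noteq> 0"
      by (meson sum.neutral)
    then show "x \<in> (\<Union>b\<in>keys ?p. keys (M b))" by (auto simp: in_keys_iff)
  qed
  also have "\<dots> \<subseteq> {..k + Suc m}" using assms Suc by fastforce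
  finally show ?case by simp
qed (simp add: basis_def)

text \<open>
  The assumption \<open>rel\<close> is row \<open>i\<close> of the matrix equation
  \<open>Y^k M = \<Sum>\<^sub>l M\<^sub>k\<^sub>l M^(k + 1 - l) Y^l\<close>, the factor \<open>X ^ l\<close> being the action of \<open>Y^l\<close> on row
  vectors. It expresses how \<open>y^k\<close> moves past one \<open>x\<close>; moving it past one \<open>x\<close> after the other gives
  \<open>Y^k M^m = \<Sum>\<^sub>l (M^m)\<^sub>k\<^sub>l M^(k + m - l) Y^l\<close>. The degree bounds keep every exponent
  nonnegative, which is what lets the two exponents of \<open>T\<close> be added.
\<close>

lemma relation_power:
  fixes M :: "'k::field matrix"
  defines "T \<equiv> lin_ext M"
  assumes degree: "\<And>k. keys (M k) \<subseteq> {..Suc k}"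
    and rel: "\<And>i k. T (basis (i + k)) = lin_ext (\<lambda>l. X ^ l * (T ^^ (Suc k - l)) (basis i)) (M k)"
  shows "(T ^^ m) (basis (i + k))
    = lin_ext (\<lambda>l. X ^ l * (T ^^ (k + m - l)) (basis i)) ((T ^^ m) (basis k))"
proof (induction m)
  case 0
  show ?case by (simp add: X_power basis_mult_basis add.commute)
next
  case (Suc m)
  have linT: "lin T" unfolding T_def by (rule lin_lin_ext)
  \<comment> \<open>By linearity, the relation holds with an arbitrary row vector in place of \<open>E\<^sub>i\<close>;
    the induction step applies it to the vectors \<open>T^(k + m - l) E\<^sub>i\<close>.\<close>
  have rel_gen: "T (X ^ k * f) = lin_ext (\<lambda>l. X ^ l * (T ^^ (Suc k - l)) f) (M k)" for k f
  proof -
    have l: "lin (\<lambda>f. lin_ext (\<lambda>l. X ^ l * (T ^^ (Suc k - l)) f) (M k))"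
      by (rule linear_smulI)
        (simp_all add: lin_ext_def lin_add[OF lin_funpow[OF linT]] lin_smul[OF lin_funpow[OF linT]]
          lin_smul[OF lin_mult] distrib_left pm.scale_right_distrib sum.distrib pm.scale_sum_right
          mult.commute)
    have "T \<circ> (*) (X ^ k) = (\<lambda>f. lin_ext (\<lambda>l. X ^ l * (T ^^ (Suc k - l)) f) (M k))"
      by (rule lin_eq_on_basis[OF lin_comp[OF linT lin_mult] l])
        (simp add: X_power[of k] basis_mult_basis rel[symmetric] add.commute[of k])
    then show ?thesis by (metis comp_apply)
  qed
  let ?p = "(T ^^ m) (basis k)"
  let ?\<psi> = "\<lambda>l. X ^ l * (T ^^ (k + Suc m - l)) (basis i)"
  have "(T ^^ Suc m) (basis (i + k)) = T (lin_ext (\<lambda>l. X ^ l * (T ^^ (k + m - l)) (basis i)) ?p)"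
    by (simp add: Suc)
  also have "\<dots> = lin_ext (\<lambda>l. T (X ^ l * (T ^^ (k + m - l)) (basis i))) ?p"
    by (rule lin_image_lin_ext[OF linT])
  also have "\<dots> = lin_ext (\<lambda>l. lin_ext ?\<psi> (M l)) ?p"
  proof (rule lin_ext_cong)
    fix l assume "l \<in> keys ?p"
    then have l: "l \<le> k + m" using funpow_degree[OF degree, of m k] by (auto simp: T_def)
    show "T (X ^ l * (T ^^ (k + m - l)) (basis i)) = lin_ext ?\<psi> (M l)"
      unfolding rel_gen
    proof (rule lin_ext_cong)
      fix l' assume "l' \<in> keys (M l)"
      then have "l' \<le> Suc l" using degree by auto
      with l have "(Suc l - l') + (k + m - l) = k + Suc m - l'" by simp
      then show "X ^ l' * (T ^^ (Suc l - l')) ((T ^^ (k + m - l)) (basis i)) = ?\<psi> l'"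
        by (metis funpow_add comp_apply)
    qed
  qed
  also have "\<dots> = lin_ext ?\<psi> (lin_ext M ?p)"
    by (rule lin_image_lin_ext[OF lin_lin_ext, symmetric])
  finally show ?case by (simp add: T_def)
qed

text \<open>
  The sufficiency of the matrix equations for the existence of a graded twisting map. The twisting
  map is the homogenization of the powers of \<open>T\<close>, as explained at the beginning.
\<close>

theorem graded_twisting_map_of_matrix:
  fixes M :: "'k::field matrix"
  defines "T \<equiv> lin_ext M"
  assumes row0: "M 0 = E 0"
    and degree: "\<And>k. keys (M k) \<subseteq> {..Suc k}"
    and rel: "\<And>i k. T (basis (i + k)) = lin_ext (\<lambda>l. X ^ l * (T ^^ (Suc k - l)) (basis i)) (M k)"
  shows "\<exists>\<tau>. twisting_map \<tau> \<and> graded \<tau> \<and> is_matrix_of M \<tau>"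
proof -
  define \<tau> :: "(nat \<times> nat \<Rightarrow>\<^sub>0 'k) \<Rightarrow> (nat \<times> nat \<Rightarrow>\<^sub>0 'k)"
    where "\<tau> = lin_ext (\<lambda>(k, i). homog (k + i) ((T ^^ i) (basis k)))"
  have lin\<tau>: "lin \<tau>" unfolding \<tau>_def by (rule lin_lin_ext)
  have linT: "lin T" unfolding T_def by (rule lin_lin_ext)
  have \<tau>: "\<tau> (basis (k, i)) = homog (k + i) ((T ^^ i) (basis k))" for k i
    by (simp add: \<tau>_def)
  have deg: "keys ((T ^^ i) (basis k)) \<subseteq> {..k + i}" for i k
    unfolding T_def by (rule funpow_degree[OF degree])
  note lins = lin_comp lin_tensor_map lin_assoc lin_unassoc lin_tensor_right lin_tensor_left
    lin\<tau> lin_mu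

  have unit_left: "\<tau> (1 \<otimes> f) = f \<otimes> 1" for f
  proof -
    have "(T ^^ i) (basis 0) = basis 0" for i
      by (induction i) (simp_all add: T_def row0)
    then have "\<tau> \<circ> (\<otimes>) 1 = (\<lambda>f. f \<otimes> 1)"
      by (intro lin_eq_on_basis lins)
        (simp add: one_eq_basis basis_tensor_basis \<tau> homog_def)
    then show ?thesis by (metis comp_apply)
  qed
  have unit_right: "\<tau> (X ^ r \<otimes> 1) = 1 \<otimes> X ^ r" for r
    by (simp add: X_power one_eq_basis basis_tensor_basis \<tau> homog_def)

  have mult_x: "\<tau> \<circ> (id \<otimes>\<^sub>m mu) \<circ> assoc
      = (mu \<otimes>\<^sub>m id) \<circ> unassoc \<circ> (id \<otimes>\<^sub>m \<tau>) \<circ> assoc \<circ> (\<tau> \<otimes>\<^sub>m id)"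
  proof (intro lin_eq_on_basis lins)
    fix b :: "(nat \<times> nat) \<times> nat"
    obtain k i i' where b: "b = ((k, i), i')" by (metis prod.exhaust)
    define G :: "(nat \<times> nat \<Rightarrow>\<^sub>0 'k) \<Rightarrow> (nat \<times> nat \<Rightarrow>\<^sub>0 'k)"
      where "G = (mu \<otimes>\<^sub>m id) \<circ> unassoc \<circ> (id \<otimes>\<^sub>m \<tau>) \<circ> assoc \<circ> (\<lambda>t. t \<otimes> basis i')"
    have linG: "lin G" unfolding G_def by (intro lins)
    let ?p = "(T ^^ i) (basis k)"
    \<comment> \<open>\<open>G\<close> multiplies a homogeneous tensor by \<open>x^i'\<close> on the right. On homogenizations this is
      \<open>T^i'\<close>, so both sides are \<open>T^i'\<close> applied after \<open>T^i\<close>.\<close>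
    have "((mu \<otimes>\<^sub>m id) \<circ> unassoc \<circ> (id \<otimes>\<^sub>m \<tau>) \<circ> assoc \<circ> (\<tau> \<otimes>\<^sub>m id)) (basis b)
        = G (homog (k + i) ?p)"
      by (simp add: b G_def tensor_map_basis \<tau>)
    also have "\<dots> = lin_ext (\<lambda>j. G (basis (k + i - j, j))) ?p"
      unfolding homog_def by (rule lin_image_lin_ext[OF linG])
    also have "\<dots> = lin_ext (\<lambda>j. homog (k + i + i') ((T ^^ i') (basis j))) ?p"
    proof (rule lin_ext_cong)
      fix j assume "j \<in> keys ?p"
      then have j: "k + i - j + (j + i') = k + i + i'" using deg[of i k] by auto
      have "G (basis (k + i - j, j))
          = (mu \<otimes>\<^sub>m id) (unassoc (basis (k + i - j) \<otimes> homog (j + i') ((T ^^ i') (basis j))))"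
        by (simp add: G_def basis_tensor_basis assoc_basis tensor_map_basis \<tau>)
      also have "\<dots> = homog (k + i + i') ((T ^^ i') (basis j))"
        using mu_left_homog[OF deg, of "k + i - j" j i'] unfolding j .
      finally show "G (basis (k + i - j, j)) = homog (k + i + i') ((T ^^ i') (basis j))" .
    qed
    also have "\<dots> = homog (k + i + i') ((T ^^ i') ?p)"
      using lin_image_lin_ext[OF lin_comp[OF lin_homog lin_funpow[OF linT]], of _ i' basis ?p]
      by (simp add: lin_ext_basis_id)
    also have "(T ^^ i') ?p = (T ^^ (i + i')) (basis k)"
      by (simp add: funpow_add add.commute[of i])
    also have "homog (k + i + i') \<dots> = (\<tau> \<circ> (id \<otimes>\<^sub>m mu) \<circ> assoc) (basis b)"
      by (simp add: b assoc_basis tensor_map_basis mu_basis basis_tensor_basis \<tau> add.assoc)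
    finally show "(\<tau> \<circ> (id \<otimes>\<^sub>m mu) \<circ> assoc) (basis b)
      = ((mu \<otimes>\<^sub>m id) \<circ> unassoc \<circ> (id \<otimes>\<^sub>m \<tau>) \<circ> assoc \<circ> (\<tau> \<otimes>\<^sub>m id)) (basis b)" by (rule sym)
  qed

  have mult_y: "\<tau> \<circ> (mu \<otimes>\<^sub>m id) \<circ> unassoc
      = (id \<otimes>\<^sub>m mu) \<circ> assoc \<circ> (\<tau> \<otimes>\<^sub>m id) \<circ> unassoc \<circ> (id \<otimes>\<^sub>m \<tau>)"
  proof (intro lin_eq_on_basis lins)
    fix b :: "nat \<times> nat \<times> nat"
    obtain k k' i where b: "b = (k, k', i)" by (metis prod.exhaust)
    define G :: "(nat \<times> nat \<Rightarrow>\<^sub>0 'k) \<Rightarrow> (nat \<times> nat \<Rightarrow>\<^sub>0 'k)"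
      where "G = (id \<otimes>\<^sub>m mu) \<circ> assoc \<circ> (\<tau> \<otimes>\<^sub>m id) \<circ> unassoc \<circ> (\<otimes>) (basis k)"
    have linG: "lin G" unfolding G_def by (intro lins)
    let ?p = "(T ^^ i) (basis k')"
    let ?\<psi> = "\<lambda>j. X ^ j * (T ^^ (k' + i - j)) (basis k)"
    \<comment> \<open>\<open>G\<close> multiplies a homogeneous tensor by \<open>y^k\<close> on the left. Applied to \<open>y^k' x^i\<close>, it yields
      the right-hand side of \<open>relation_power\<close>.\<close>
    have "((id \<otimes>\<^sub>m mu) \<circ> assoc \<circ> (\<tau> \<otimes>\<^sub>m id) \<circ> unassoc \<circ> (id \<otimes>\<^sub>m \<tau>)) (basis b)
        = G (homog (k' + i) ?p)"
      by (simp add: b G_def tensor_map_basis \<tau>)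
    also have "\<dots> = lin_ext (\<lambda>j. G (basis (k' + i - j, j))) ?p"
      unfolding homog_def by (rule lin_image_lin_ext[OF linG])
    also have "\<dots> = lin_ext (\<lambda>j. homog (k + k' + i) (?\<psi> j)) ?p"
    proof (rule lin_ext_cong)
      fix j assume "j \<in> keys ?p"
      then have j: "k + (k' + i - j) + j = k + k' + i" using deg[of i k'] by auto
      have "G (basis (k' + i - j, j)) = (id \<otimes>\<^sub>m mu) (assoc
          (homog (k + (k' + i - j)) ((T ^^ (k' + i - j)) (basis k)) \<otimes> basis j))"
        by (simp add: G_def basis_tensor_basis unassoc_basis tensor_map_basis \<tau>)
      then show "G (basis (k' + i - j, j)) = homog (k + k' + i) (?\<psi> j)"
        by (simp only: mu_right_homog j)
    qed
    also have "\<dots> = homog (k + k' + i) (lin_ext ?\<psi> ?p)"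
      by (rule lin_image_lin_ext[OF lin_homog, symmetric])
    also have "lin_ext ?\<psi> ?p = (T ^^ i) (basis (k + k'))"
      using relation_power[OF degree rel[unfolded T_def], of i k k'] by (simp add: T_def)
    also have "homog (k + k' + i) \<dots> = (\<tau> \<circ> (mu \<otimes>\<^sub>m id) \<circ> unassoc) (basis b)"
      by (simp add: b unassoc_basis tensor_map_basis mu_basis basis_tensor_basis \<tau>)
    finally show "(\<tau> \<circ> (mu \<otimes>\<^sub>m id) \<circ> unassoc) (basis b)
      = ((id \<otimes>\<^sub>m mu) \<circ> assoc \<circ> (\<tau> \<otimes>\<^sub>m id) \<circ> unassoc \<circ> (id \<otimes>\<^sub>m \<tau>)) (basis b)" by (rule sym)
  qed

  have "graded \<tau>"
    unfolding graded_def
  proof (intro allI)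
    fix r i :: nat
    have "X ^ (r + i - j) \<otimes> X ^ j \<in> pm.span {X ^ (r + i - j) \<otimes> X ^ j |j. j \<le> r + i}"
      if "j \<in> keys ((T ^^ i) (basis r))" for j
      using that deg[of i r] by (intro pm.span_base) auto
    then show "\<tau> (X ^ r \<otimes> X ^ i) \<in> pm.span {X ^ (r + i - j) \<otimes> X ^ j |j. j \<le> r + i}"
      unfolding X_power basis_tensor_basis \<tau> homog_def lin_ext_def
      by (intro pm.span_sum pm.span_scale) auto
  qed
  moreover have "is_matrix_of M \<tau>"
    unfolding is_matrix_of_def
  proof (intro conjI allI impI)
    fix k j :: nat
    assume "k + 1 < j"
    then show "lookup (M k) j = 0" using degree[of k] by (force simp: in_keys_iff)
  next
    fix k :: nat
    have "\<tau> (X ^ k \<otimes> X) = homog (k + 1) (M k)"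
      unfolding X_power unfolding X_eq_basis by (simp add: basis_tensor_basis \<tau> T_def)
    also have "\<dots> = (\<Sum>j = 0..k + 1. smul (lookup (M k) j) (basis (k + 1 - j, j)))"
      unfolding homog_def
      by (rule lin_ext_superset) (use degree[of k] in auto)
    finally show "\<tau> (X ^ k \<otimes> X) = (\<Sum>j = 0..k + 1. smul (lookup (M k) j)
        (X ^ (k + 1 - j) \<otimes> X ^ j))"
      by (simp only: X_power basis_tensor_basis)
  qed
  ultimately show ?thesis
    unfolding twisting_map_def using lin\<tau> unit_left unit_right mult_x mult_y by blast
qed


section \<open>Matrices attached to nearly additive functions\<close>

text \<open>
  Here \<open>\<kappa>\<close> is additive up to a defect that is always 0 or 1. Both sides are sums of two
  powers of \<open>d\<close> with exponents 0 or 1. By the cocycle identity for the defect, the exponents on the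
  two sides have the same sum; and two numbers from \<open>{0, 1}\<close> are determined up to order by
  their sum.
\<close>

lemma nearly_additive_exchange:
  fixes d q :: "'k::field" and \<kappa> :: "nat \<Rightarrow> nat"
  assumes dq: "d * q = 1"
    and "\<kappa> 1 = 0"
    and lower: "\<And>i j. \<kappa> i + \<kappa> j \<le> \<kappa> (i + j)"
    and upper: "\<And>i j. \<kappa> (i + j) \<le> \<kappa> i + \<kappa> j + 1"
  shows "d ^ \<kappa> (i + j + 1) * q ^ (\<kappa> i + \<kappa> (j + 1)) + q ^ \<kappa> j * d ^ \<kappa> (j + 1)
    = d ^ \<kappa> (i + j) * q ^ (\<kappa> i + \<kappa> j) + q ^ \<kappa> (i + j) * d ^ \<kappa> (i + j + 1)"
proof -
  have pow: "d ^ s * q ^ t = d ^ (s - t)" if "t \<le> s" for s t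
  proof -
    have "d ^ s * q ^ t = d ^ (s - t) * (d * q) ^ t"
      using that by (simp add: power_mult_distrib mult.assoc[symmetric] power_add[symmetric])
    then show ?thesis by (simp add: dq)
  qed
  obtain s where s: "\<kappa> (i + j) = \<kappa> i + \<kappa> j + s" "s \<le> 1"
    using lower[of i j] upper[of i j] by (metis add_le_cancel_left le_Suc_ex)
  obtain t where t: "\<kappa> (j + 1) = \<kappa> j + t" "t \<le> 1"
    using lower[of j 1] upper[of j 1] \<open>\<kappa> 1 = 0\<close> by (metis add_0_right add_le_cancel_left le_Suc_ex)
  obtain u where u: "\<kappa> (i + j + 1) = \<kappa> (i + j) + u" "u \<le> 1"
    using lower[of "i + j" 1] upper[of "i + j" 1] \<open>\<kappa> 1 = 0\<close>
    by (metis add_0_right add_le_cancel_left le_Suc_ex)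
  obtain v where v: "\<kappa> (i + j + 1) = \<kappa> i + \<kappa> (j + 1) + v" "v \<le> 1"
    using lower[of i "j + 1"] upper[of i "j + 1"]
    by (metis add_le_cancel_left le_Suc_ex add.assoc)
  have "v + t = s + u" using s t u v by simp
  then have "v = s \<and> t = u \<or> v = u \<and> t = s" using s(2) t(2) u(2) v(2) by linarith
  then have "d ^ v + d ^ t = d ^ s + d ^ u" by auto
  moreover have "d ^ \<kappa> (i + j + 1) * q ^ (\<kappa> i + \<kappa> (j + 1)) = d ^ v"
    using pow[of "\<kappa> i + \<kappa> (j + 1)" "\<kappa> (i + j + 1)"] v by simp
  moreover have "q ^ \<kappa> j * d ^ \<kappa> (j + 1) = d ^ t"
    using pow[of "\<kappa> j" "\<kappa> (j + 1)"] t by (simp add: mult.commute)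
  moreover have "d ^ \<kappa> (i + j) * q ^ (\<kappa> i + \<kappa> j) = d ^ s"
    using pow[of "\<kappa> i + \<kappa> j" "\<kappa> (i + j)"] s by simp
  moreover have "q ^ \<kappa> (i + j) * d ^ \<kappa> (i + j + 1) = d ^ u"
    using pow[of "\<kappa> (i + j)" "\<kappa> (i + j + 1)"] u by (simp add: mult.commute)
  ultimately show ?thesis by simp
qed

text \<open>
  The matrices of this lemma are those that take, in the basis \<open>e\<^sub>j = q^(\<kappa> j) y^j\<close>, the form
  \<open>T e\<^sub>j = e\<^sub>j\<^sub>+\<^sub>1 - e\<^sub>1 + u\<^sub>j e\<^sub>0\<close> with \<open>u\<^sub>j = d^(\<kappa> (j + 1) - \<kappa> j)\<close>. The defect of
  \<open>\<kappa>\<close> enters as the exponent in the constant term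
  \<open>c i j = d^(\<kappa> (i + j) - \<kappa> i - \<kappa> j)\<close> of \<open>T^j e\<^sub>i\<close>, and the exchange identity is
  both the recursion for \<open>c\<close> and, once rescaled, the relation between the coefficients of
  \<open>y^(i + k + 1)\<close> in the matrix equation.
\<close>

lemma nearly_additive_graded_twisting_map:
  fixes d q :: "'k::field" and \<kappa> :: "nat \<Rightarrow> nat"
  assumes dq: "d * q = 1"
    and \<kappa>0: "\<kappa> 0 = 0" and \<kappa>1: "\<kappa> 1 = 0"
    and lower: "\<And>i j. \<kappa> i + \<kappa> j \<le> \<kappa> (i + j)"
    and upper: "\<And>i j. \<kappa> (i + j) \<le> \<kappa> i + \<kappa> j + 1"
    and M: "\<And>j. M j = smul (d ^ \<kappa> (j + 1)) (E 0) - smul (d ^ \<kappa> j) (E 1)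
      + smul (d ^ \<kappa> j * q ^ \<kappa> (j + 1)) (E (j + 1))"
  shows "\<exists>\<tau>. twisting_map \<tau> \<and> graded \<tau> \<and> is_matrix_of M \<tau>"
proof (rule graded_twisting_map_of_matrix)
  show row0: "M 0 = E 0" using \<kappa>0 \<kappa>1 by (simp add: M)
  show "keys (M k) \<subseteq> {..Suc k}" for k
    by (auto simp: in_keys_iff M lookup_add lookup_minus lookup_basis split: if_splits)
  fix i k :: nat
  define T where "T = lin_ext M"
  define e where "e j = smul (q ^ \<kappa> j) (E j)" for j
  define c where "c i j = d ^ \<kappa> (i + j) * q ^ (\<kappa> i + \<kappa> j)" for i j
  have linT: "lin T" unfolding T_def by (rule lin_lin_ext)
  have dq': "d ^ m * q ^ m = 1" for m
    by (simp add: dq power_mult_distrib[symmetric])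
  have E: "E j = smul (d ^ \<kappa> j) (e j)" for j
    by (simp add: e_def dq')
  have e0: "e 0 = E 0" by (simp add: e_def \<kappa>0)
  have T_E: "T (E j) = M j" for j by (simp add: T_def)
  have T_e: "T (e j) = smul (q ^ \<kappa> j * d ^ \<kappa> (j + 1)) (E 0) - E 1 + e (j + 1)" for j
    using dq'[of "\<kappa> j"]
    by (simp add: e_def lin_smul[OF linT] T_E M pm.scale_right_distrib pm.scale_right_diff_distrib
        mult.commute mult.assoc[symmetric])
  have T_power: "(T ^^ j) (e i) = e (i + j) - e j + smul (c i j) (E 0)" for i j
  proof (induction j)
    case 0
    show ?case using dq'[of "\<kappa> i"] by (simp add: e0 c_def \<kappa>0)
  next
    case (Suc j)
    have c: "c i (j + 1) = q ^ \<kappa> (i + j) * d ^ \<kappa> (i + j + 1) - q ^ \<kappa> j * d ^ \<kappa> (j + 1) + c i j"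
      using nearly_additive_exchange[of d q \<kappa> i j, OF dq \<kappa>1 lower upper]
      by (simp add: c_def algebra_simps)
    have "(T ^^ Suc j) (e i) = T (e (i + j)) - T (e j) + smul (c i j) (E 0)"
      by (simp add: Suc lin_add[OF linT] lin_diff[OF linT] lin_smul[OF linT] T_E row0)
    also have "\<dots> = e (i + (j + 1)) - e (j + 1) + smul (c i (j + 1)) (E 0)"
      unfolding T_e c
      by (simp add: pm.scale_left_distrib pm.scale_left_diff_distrib add.assoc)
    finally show ?case by simp
  qed
  \<comment> \<open>The exchange identity multiplied by \<open>d^(\<kappa> k) q^(\<kappa> (i + k + 1))\<close>.\<close>
  have Q: "d ^ \<kappa> (i + k) * q ^ \<kappa> i * q ^ \<kappa> (i + k + 1)
      = d ^ \<kappa> (k + 1) * q ^ \<kappa> (i + k + 1) - d ^ \<kappa> k * q ^ \<kappa> (i + k)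
        + d ^ \<kappa> k * q ^ \<kappa> (k + 1) * q ^ \<kappa> i"
  proof -
    have "x * v * w = z * w - r * y + r * t * v"
      if "p * (v * t) + s * z = x * (v * s) + y * p" "r * s = 1" "p * w = 1"
      for p r s t v w x y z :: 'k
      using that by algebra
    from this[OF nearly_additive_exchange[of d q \<kappa> i k, OF dq \<kappa>1 lower upper,
          unfolded power_add] dq' dq']
    show ?thesis .
  qed
  have X_E: "X * E j = E (j + 1)" for j
    by (simp add: X_eq_basis basis_mult_basis)
  have X_e: "X * e j = smul (q ^ \<kappa> j) (E (j + 1))" for j
    by (simp add: e_def lin_smul[OF lin_mult] X_E)
  \<comment> \<open>The matrix equation applied to \<open>e\<^sub>i\<close> instead of \<open>E\<^sub>i\<close>: as \<open>M k\<close> is a combination of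
    \<open>E\<^sub>0\<close>, \<open>E\<^sub>1\<close> and \<open>E\<^sub>k\<^sub>+\<^sub>1\<close>, its right-hand side has three terms.\<close>
  have "smul (d ^ \<kappa> (i + k) * q ^ \<kappa> i) (T (e (i + k)))
    = smul (d ^ \<kappa> (k + 1)) ((T ^^ Suc k) (e i)) - smul (d ^ \<kappa> k) (X * (T ^^ k) (e i))
      + smul (d ^ \<kappa> k * q ^ \<kappa> (k + 1)) (X ^ (k + 1) * e i)"
  proof (rule poly_mapping_eqI)
    fix x
    \<comment> \<open>The variables \<open>z0\<close>, \<open>z1\<close>, \<open>z2\<close>, \<open>z3\<close> stand for the entries at \<open>x\<close> of \<open>E\<^sub>0\<close>, \<open>E\<^sub>1\<close>,
      \<open>E\<^sub>k\<^sub>+\<^sub>1\<close>, \<open>E\<^sub>i\<^sub>+\<^sub>k\<^sub>+\<^sub>1\<close>; comparing their coefficients is valid even if some of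
      these vectors coincide.\<close>
    have coeff: "A * B * (G * D' * z0 - z1 + C * z3)
      = D * (C * z3 - H * z2 + D' * (B * H) * z0) - F * (G * z3 - J * z2 + A * (B * J) * z1)
        + F * H * (B * z3)"
      if "A * B * C = D * C - F * G + F * H * B" "F * J = 1" "D * H = 1" "A * G = 1"
      for A B C D D' F G H J z0 z1 z2 z3 :: 'k
      using that by algebra
    have X_T: "X * (T ^^ k) (e i) = smul (q ^ \<kappa> (i + k)) (E (i + k + 1))
        - smul (q ^ \<kappa> k) (E (k + 1)) + smul (c i k) (E 1)"
      unfolding T_power by (simp add: lin_add[OF lin_mult] lin_diff[OF lin_mult]
          lin_smul[OF lin_mult] X_e X_E)
    have X_pow: "X ^ (k + 1) * e i = smul (q ^ \<kappa> i) (E (i + k + 1))"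
      unfolding X_power by (simp add: e_def lin_smul[OF lin_mult] basis_mult_basis add.commute)
    show "lookup (smul (d ^ \<kappa> (i + k) * q ^ \<kappa> i) (T (e (i + k)))) x
      = lookup (smul (d ^ \<kappa> (k + 1)) ((T ^^ Suc k) (e i)) - smul (d ^ \<kappa> k) (X * (T ^^ k) (e i))
        + smul (d ^ \<kappa> k * q ^ \<kappa> (k + 1)) (X ^ (k + 1) * e i)) x"
      unfolding X_T X_pow
      unfolding T_power T_e
      unfolding e_def c_def Suc_eq_plus1 lookup_add lookup_minus lookup_smul power_add
        add.assoc[symmetric]
      by (rule coeff[OF Q dq' dq' dq'])
  qed
  moreover have "smul (d ^ \<kappa> i) (smul (d ^ \<kappa> (i + k) * q ^ \<kappa> i) (T (e (i + k)))) = T (E (i + k))"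
    using dq'[of "\<kappa> i"] by (simp add: E[of "i + k"] lin_smul[OF linT] mult.assoc mult.left_commute)
  moreover have "lin_ext (\<lambda>l. X ^ l * (T ^^ (Suc k - l)) (E i)) (M k)
    = smul (d ^ \<kappa> i) (smul (d ^ \<kappa> (k + 1)) ((T ^^ Suc k) (e i)) - smul (d ^ \<kappa> k) (X * (T ^^ k) (e i))
      + smul (d ^ \<kappa> k * q ^ \<kappa> (k + 1)) (X ^ (k + 1) * e i))"
    unfolding M lin_add[OF lin_lin_ext] lin_diff[OF lin_lin_ext] lin_smul[OF lin_lin_ext]
      lin_ext_basis E[of i] lin_smul[OF lin_funpow[OF linT]] lin_smul[OF lin_mult]
    by (simp add: pm.scale_right_distrib pm.scale_right_diff_distrib mult.left_commute mult.commute)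
  ultimately show "lin_ext M (E (i + k))
      = lin_ext (\<lambda>l. X ^ l * (lin_ext M ^^ (Suc k - l)) (E i)) (M k)"
    unfolding T_def by simp
qed


section \<open>Quasi-balanced sequences\<close>

text \<open>
  For an increasing sequence \<open>L\<^sub>1 < L\<^sub>2 < \<dots>\<close>, this is the number of terms smaller than \<open>j\<close>:
  it is \<open>k\<close> for \<open>L\<^sub>k < j \<le> L\<^sub>k\<^sub>+\<^sub>1\<close>, and 0 for \<open>j \<le> L\<^sub>1\<close>. The least-index form makes the
  bounds \<open>L\<^sub>k < j \<le> L\<^sub>k\<^sub>+\<^sub>1\<close> immediate.
\<close>

definition count_below :: "(nat \<Rightarrow> nat) \<Rightarrow> nat \<Rightarrow> nat"
  where "count_below L j = (LEAST k. j \<le> L (k + 1))"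

lemma Delta_ge_index:
  assumes "L \<in> Delta n" "1 \<le> k"
  shows "k \<le> L k"
  using assms(2)
proof (induction k rule: dec_induct)
  case base
  then show ?case using assms(1) by (auto simp: Delta_def)
next
  case (step k)
  then show ?case using Delta_less[OF assms(1), of k "Suc k"] by simp
qed

lemma count_below_upper:
  assumes "L \<in> Delta n"
  shows "j \<le> L (count_below L j + 1)"
  unfolding count_below_def
  by (rule LeastI[of "\<lambda>k. j \<le> L (k + 1)" j]) (use Delta_ge_index[OF assms, of "j + 1"] in simp)

lemma count_below_lower: "0 < count_below L j \<Longrightarrow> L (count_below L j) < j"
  using not_less_Least[of "count_below L j - 1" "\<lambda>k. j \<le> L (k + 1)"]
  by (auto simp: count_below_def)

lemma count_below_le: "j \<le> L (k + 1) \<Longrightarrow> count_below L j \<le> k"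
  unfolding count_below_def by (rule Least_le)

lemma count_below_ge:
  assumes "L \<in> Delta n" "1 \<le> k" "L k < j"
  shows "k \<le> count_below L j"
proof (rule ccontr)
  assume "\<not> k \<le> count_below L j"
  then have "L (count_below L j + 1) \<le> L k"
    using Delta_less[OF assms(1), of "count_below L j + 1" k]
    by (cases "count_below L j + 1 = k") auto
  with assms(3) count_below_upper[OF assms(1), of j] show False by simp
qed

text \<open>
  With \<open>L\<^sub>s < i \<le> L\<^sub>s\<^sub>+\<^sub>1\<close> and \<open>L\<^sub>t < j \<le> L\<^sub>t\<^sub>+\<^sub>1\<close>, quasi-balancedness gives
  \<open>L\<^sub>s\<^sub>+\<^sub>t \<le> L\<^sub>s + L\<^sub>t + 1 < i + j \<le> L\<^sub>s\<^sub>+\<^sub>1 + L\<^sub>t\<^sub>+\<^sub>1 \<le> L\<^sub>s\<^sub>+\<^sub>t\<^sub>+\<^sub>2\<close>. The defect 1 allowed in the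
  lower bound is absorbed because both inequalities \<open>L\<^sub>s < i\<close> and \<open>L\<^sub>t < j\<close> are strict.
  If \<open>s\<close> or \<open>t\<close> is 0, the lower bound is monotonicity of the count.
\<close>

lemma quasi_balanced_count_below:
  assumes "L \<in> quasi_balanced n"
  shows "count_below L i + count_below L j \<le> count_below L (i + j)"
    and "count_below L (i + j) \<le> count_below L i + count_below L j + 1"
proof -
  let ?\<kappa> = "count_below L"
  have L: "L \<in> Delta n" using assms by (simp add: quasi_balanced_def)
  have qb: "L (s + t) \<le> L s + L t + 1" "L s + L t \<le> L (s + t)" if "0 < s" "0 < t" for s t
  proof -
    have "0 < s \<and> s < s + t" using that by simp
    then have "L (s + t) - 1 \<le> L s + L (s + t - s) \<and> L s + L (s + t - s) \<le> L (s + t)"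
      using assms unfolding quasi_balanced_def by blast
    then show "L (s + t) \<le> L s + L t + 1" "L s + L t \<le> L (s + t)" by auto
  qed
  have "i + j \<le> L (?\<kappa> i + 1) + L (?\<kappa> j + 1)"
    by (intro add_mono count_below_upper[OF L])
  also have "\<dots> \<le> L (?\<kappa> i + ?\<kappa> j + 1 + 1)"
    using qb(2)[of "?\<kappa> i + 1" "?\<kappa> j + 1"] by (simp add: add.assoc add.left_commute)
  finally show "?\<kappa> (i + j) \<le> ?\<kappa> i + ?\<kappa> j + 1" by (rule count_below_le)
  show "?\<kappa> i + ?\<kappa> j \<le> ?\<kappa> (i + j)"
  proof (cases "?\<kappa> i + ?\<kappa> j = 0")
    case False
    have "L (?\<kappa> i + ?\<kappa> j) < i + j"
    proof (cases "?\<kappa> i = 0 \<or> ?\<kappa> j = 0")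
      case True
      then show ?thesis
        using False count_below_lower[of L i] count_below_lower[of L j] by auto
    next
      case False
      then show ?thesis
        using qb(1)[of "?\<kappa> i" "?\<kappa> j"] count_below_lower[of L i] count_below_lower[of L j] by simp
    qed
    with False show ?thesis by (intro count_below_ge[OF L]) auto
  qed simp
qed

text \<open>
  The count jumps by 1 from \<open>j\<close> to \<open>j + 1\<close> exactly when \<open>j\<close> is a term of \<open>L\<close>. This puts the three
  cases in the definition of \<open>M(L,a)\<close> into one formula: at a jump the last coefficient is
  \<open>1 + a\<close>, the entry \<open>a\<close> of \<open>M(L,a)\<close> plus the entry 1 of \<open>Y\<close>, and elsewhere it is 1.
\<close>

lemma M_tilde_plus_Y:
  fixes a :: "'k::field"
  assumes L: "L \<in> Delta n" and a: "1 + a \<noteq> 0"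
  defines "d \<equiv> 1 / (1 + a)" and "\<kappa> \<equiv> count_below L"
  shows "M_tilde L a j + Y j = smul (d ^ \<kappa> (j + 1)) (E 0) - smul (d ^ \<kappa> j) (E 1)
    + smul (d ^ \<kappa> j * (1 + a) ^ \<kappa> (j + 1)) (E (j + 1))"
proof (cases "j = L (\<kappa> j + 1)")
  case True
  have "j + 1 \<le> L (\<kappa> j + 1 + 1)"
    using Delta_less[OF L, of "\<kappa> j + 1" "\<kappa> j + 1 + 1"] True by simp
  then have \<kappa>: "\<kappa> (j + 1) = \<kappa> j + 1"
    using count_below_le[of "j + 1" L "\<kappa> j + 1"] count_below_ge[OF L, of "\<kappa> j + 1" "j + 1"] True
    by (simp add: \<kappa>_def)
  have "M_tilde L a j = smul (d ^ (\<kappa> j + 1)) (E 0) - smul (d ^ \<kappa> j) (E 1) + smul a (E (j + 1))"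
    using M_tilde_eq[OF L _ True, of a] True by (simp add: d_def)
  moreover have "d ^ \<kappa> j * (1 + a) ^ (\<kappa> j + 1) = a + 1"
    using a by (simp add: d_def power_divide)
  ultimately show ?thesis
    unfolding \<kappa> Y_def by (simp add: pm.scale_left_distrib add.assoc)
next
  case False
  then have less: "j < L (\<kappa> j + 1)"
    using count_below_upper[OF L, of j] by (simp add: \<kappa>_def)
  have \<kappa>: "\<kappa> (j + 1) = \<kappa> j"
  proof (rule antisym)
    show "\<kappa> (j + 1) \<le> \<kappa> j" using less count_below_le[of "j + 1" L "\<kappa> j"] by (simp add: \<kappa>_def)
    show "\<kappa> j \<le> \<kappa> (j + 1)"
      using count_below_ge[OF L, of "\<kappa> j" "j + 1"] count_below_lower[of L j]
      by (cases "\<kappa> j = 0") (auto simp: \<kappa>_def)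
  qed
  have "M_tilde L a j = smul (d ^ \<kappa> j) (E 0 - E 1)"
  proof (cases "\<kappa> j = 0")
    case True
    with less show ?thesis by (simp add: M_tilde_less)
  next
    case False
    then show ?thesis
      using M_tilde_between[OF L _ _ less, of a] count_below_lower[of L j]
      by (simp add: d_def \<kappa>_def)
  qed
  moreover have "d ^ \<kappa> j * (1 + a) ^ \<kappa> j = 1"
    using a by (simp add: d_def power_divide)
  ultimately show ?thesis
    unfolding \<kappa> Y_def by (simp add: pm.scale_right_diff_distrib)
qed

theorem proposition9p9:
  fixes n :: nat and a :: "'k::field" and L :: "nat \<Rightarrow> nat"
  assumes "n \<ge> 2" and "a \<noteq> 0" and "a \<noteq> -1"
    and "L \<in> quasi_balanced n"
  shows "\<exists>\<tau>. twisting_map \<tau> \<and> graded \<tau> \<and> is_matrix_of (\<lambda>i. M_tilde L a i + Y i) \<tau>"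
proof -
  have L: "L \<in> Delta n" using assms(4) by (simp add: quasi_balanced_def)
  have a: "1 + a \<noteq> 0" using assms(3) by (metis add_eq_0_iff)
  have "1 \<le> L (0 + 1)" using Delta_ge_index[OF L, of 1] by simp
  then have "count_below L 0 = 0" "count_below L 1 = 0"
    using count_below_le[of _ L 0] by fastforce+
  then show ?thesis
    using a
    by (intro nearly_additive_graded_twisting_map[where d="1 / (1 + a)" and q="1 + a"
          and \<kappa>="count_below L"] M_tilde_plus_Y[OF L a] quasi_balanced_count_below[OF assms(4)])
      auto
qed

end
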